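(* For every finite rooted ordered tree $T$, $(T^* )^*=T$ (as rooted ordered trees on the same vertex set).
   Context: For a rooted ordered tree $T$ with root $r$, $rmc_T(u)$ is the rightmost child and $ils_T(u)$ the immediate left sibling of $u$ in $T$. The dual $T^*$ has the same vertex set and root $r$, with parents and sibling order given by: (1a) $r$ has no parent in $T^*$; (1b) if $v=rmc_T(r)$ then $v$ is the rightmost child of $r$ in $T^*$; (2) if $v=rmc_T(u)$ with $u\ne r$, then $v$ is the immediate left sibling of $u$ in $T^*$ (so $v$ and $u$ have the same parent in $T^*$); (3) if $v=ils_T(u)$, then $v$ is the rightmost child of $u$ in $T^*$. $T^*$ is itself a rooted ordered tree, so $(T^* )^*$ is defined. *)

theory Defs
  imports Main
begin

text \<open>
  A rooted ordered tree carries its own vertex set; \<open>children T u\<close> lists the children of \<open>u\<close>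
  from left to right, so it encodes both the parent relation and the order of siblings.
\<close>

record 'a rotree =
  verts :: "'a set"
  root :: 'a
  children :: "'a \<Rightarrow> 'a list"

text \<open>
  The list of children is required to be empty outside the vertex set, so that equality of
  records is equality of rooted ordered trees. Finiteness is not included.
\<close>

definition rooted_ordered_tree :: "'a rotree \<Rightarrow> bool" where
  "rooted_ordered_tree T \<longleftrightarrow>
     root T \<in> verts T \<and>
     (\<forall>u. u \<notin> verts T \<longrightarrow> children T u = []) \<and>
     (\<forall>u \<in> verts T. set (children T u) \<subseteq> verts T \<and> distinct (children T u)) \<and>
     (\<forall>u. root T \<notin> set (children T u)) \<and>
     (\<forall>v \<in> verts T - {root T}. \<exists>!u. v \<in> set (children T u)) \<and>
     (\<forall>v \<in> verts T. (root T, v) \<in> {(u, w). w \<in> set (children T u)}\<^sup>*)"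

text \<open>
  Rightmost children and immediate left siblings need not exist, hence relations:
  \<open>is_rmc T v u\<close> means \<open>v = rmc\<^sub>T(u)\<close> and \<open>is_ils T v u\<close> means \<open>v = ils\<^sub>T(u)\<close>.
\<close>

definition is_rmc :: "'a rotree \<Rightarrow> 'a \<Rightarrow> 'a \<Rightarrow> bool" where
  "is_rmc T v u \<longleftrightarrow> children T u \<noteq> [] \<and> v = last (children T u)"

definition is_ils :: "'a rotree \<Rightarrow> 'a \<Rightarrow> 'a \<Rightarrow> bool" where
  "is_ils T v u \<longleftrightarrow> (\<exists>p xs ys. children T p = xs @ [v, u] @ ys)"

text \<open>
  That the root has no parent in the dual is part of \<open>rooted_ordered_tree S\<close> together with
  \<open>root S = root T\<close>.
\<close>

definition is_dual :: "'a rotree \<Rightarrow> 'a rotree \<Rightarrow> bool" where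
  "is_dual T S \<longleftrightarrow>
     rooted_ordered_tree S \<and> verts S = verts T \<and> root S = root T \<and>
     (\<forall>v. is_rmc T v (root T) \<longrightarrow> is_rmc S v (root T)) \<and>
     (\<forall>u v. u \<noteq> root T \<longrightarrow> is_rmc T v u \<longrightarrow> is_ils S v u) \<and>
     (\<forall>u v. is_ils T v u \<longrightarrow> is_rmc S v u)"

text \<open>
  For a finite rooted ordered tree \<open>T\<close> the three rules fix, for every non-root vertex, either its
  parent (as rightmost child) or its immediate right sibling, so exactly one such \<open>S\<close> exists.
\<close>

definition dual :: "'a rotree \<Rightarrow> 'a rotree" where
  "dual T = (THE S. is_dual T S)"

end

(* Every non-root vertex is either the rightmost child or the immediate left sibling of exactly one
   vertex, and a tree is determined by these two relations. Dualizing exchanges the two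
   relations, except that the rightmost child of the root stays where it is; so being a dual is a
   symmetric relation, and a tree has at most one dual. Existence is where finiteness enters: the
   children of u in the dual form a chain of successive rightmost children in T, which starts at
   the immediate left sibling of u (or at the rightmost child of the root) and has to end. *)

theory Submission
  imports Defs
begin

section \<open>Rightmost children and immediate left siblings\<close>

abbreviation child_rel :: "'a rotree \<Rightarrow> 'a rel" where
  "child_rel T \<equiv> {(u, w). w \<in> set (children T u)}"

lemma child_in_verts:
  assumes "rooted_ordered_tree T" and "w \<in> set (children T u)"
  shows "u \<in> verts T" "w \<in> verts T" "w \<noteq> root T"
  using assms unfolding rooted_ordered_tree_def by force+

lemma parent_unique:
  assumes "rooted_ordered_tree T"
    and "w \<in> set (children T u)" "w \<in> set (children T u')"
  shows "u = u'"
  using assms child_in_verts[OF assms(1,2)] unfolding rooted_ordered_tree_def by blast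

lemma parent_exists:
  assumes "rooted_ordered_tree T" and "v \<in> verts T" "v \<noteq> root T"
  obtains u where "v \<in> set (children T u)"
  using assms unfolding rooted_ordered_tree_def by blast

lemma distinct_children:
  assumes "rooted_ordered_tree T"
  shows "distinct (children T u)"
  using assms unfolding rooted_ordered_tree_def by (cases "u \<in> verts T") auto

lemma is_rmc_child: "is_rmc T v u \<Longrightarrow> v \<in> set (children T u)"
  by (auto simp: is_rmc_def)

lemma is_ils_siblings:
  assumes "is_ils T v u"
  obtains p where "v \<in> set (children T p)" "u \<in> set (children T p)"
proof -
  obtain p xs ys where "children T p = xs @ [v, u] @ ys"
    using assms unfolding is_ils_def by blast
  then show thesis using that[of p] by simp
qed

lemma is_rmc_parent_unique:
  assumes "rooted_ordered_tree T" "is_rmc T v u" "is_rmc T v u'"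
  shows "u = u'"
  using assms parent_unique is_rmc_child by metis

lemma is_ils_right_unique:
  assumes T: "rooted_ordered_tree T" and "is_ils T v u" "is_ils T v u'"
  shows "u = u'"
proof -
  obtain p xs ys where p: "children T p = xs @ v # u # ys"
    using assms(2) unfolding is_ils_def by auto
  obtain q xs' ys' where q: "children T q = xs' @ v # u' # ys'"
    using assms(3) unfolding is_ils_def by auto
  have "p = q" by (rule parent_unique[OF T, of v]) (simp_all add: p q)
  with p q have "xs @ v # u # ys = xs' @ v # u' # ys'" by simp
  moreover have "v \<notin> set xs" "v \<notin> set (u # ys)"
    using distinct_children[OF T, of p] by (auto simp: p)
  ultimately have "u # ys = u' # ys'" by (subst (asm) append_Cons_eq_iff) auto
  then show ?thesis by simp
qed

text \<open>The parent of \<open>u\<close> is unique and lists \<open>u\<close> only once, so every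
  decomposition around \<open>u\<close> is the one witnessing \<open>is_ils\<close>. This lets a
  known suffix grow to the left in \<open>children_suffix\<close>.\<close>

lemma is_ils_append:
  assumes T: "rooted_ordered_tree T" and "is_ils T v u" and p: "children T p = xs @ u # zs"
  obtains xs' where "xs = xs' @ [v]"
proof -
  obtain q ys ws where q: "children T q = (ys @ [v]) @ u # ws"
    using assms(2) unfolding is_ils_def by auto
  have "p = q" by (rule parent_unique[OF T, of u]) (simp_all add: p q)
  with p q have "xs @ u # zs = (ys @ [v]) @ u # ws" by simp
  moreover have "u \<notin> set xs" "u \<notin> set zs"
    using distinct_children[OF T, of p] by (auto simp: p)
  ultimately have "xs = ys @ [v]" by (subst (asm) append_Cons_eq_iff) auto
  then show thesis by (rule that)
qed

lemma is_ils_left_unique: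
  assumes T: "rooted_ordered_tree T" and "is_ils T v u" "is_ils T v' u"
  shows "v = v'"
proof -
  obtain p xs zs where p: "children T p = (xs @ [v]) @ u # zs"
    using assms(2) unfolding is_ils_def by auto
  show ?thesis using is_ils_append[OF T assms(3) p] by auto
qed

text \<open>Distinctness keeps a last entry from also having a successor. Together with
  \<open>child_cases\<close> this makes the two roles of a non-root vertex a strict
  alternative.\<close>

lemma not_is_ils_and_is_rmc:
  assumes T: "rooted_ordered_tree T" and "is_ils T v u" "is_rmc T v p"
  shows False
proof -
  obtain q xs ys where q: "children T q = xs @ v # u # ys"
    using assms(2) unfolding is_ils_def by auto
  have "p = q"
    by (rule parent_unique[OF T, of v]) (use is_rmc_child[OF assms(3)] q in auto)
  with assms(3) q distinct_children[OF T, of p] show False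
    by (auto simp: is_rmc_def split: if_splits)
qed

lemma child_cases:
  assumes "v \<in> set (children T p)"
  obtains "is_rmc T v p" | u where "is_ils T v u"
proof -
  obtain xs ys where p: "children T p = xs @ v # ys"
    using assms by (meson split_list)
  show thesis
  proof (cases ys)
    case Nil
    with p show thesis by (auto simp: is_rmc_def intro: that(1))
  next
    case (Cons u ws)
    with p have "is_ils T v u" unfolding is_ils_def by auto
    then show thesis by (rule that(2))
  qed
qed

text \<open>The list is rebuilt from the right: \<open>is_rmc\<close> fixes the last entry, and each
  \<open>is_ils\<close> fact fixes the entry before a known one. With implications in one direction
  only, nothing bounds the list in \<open>T'\<close> on the left, hence a suffix.\<close>

lemma children_suffix:
  assumes T: "rooted_ordered_tree T" "rooted_ordered_tree T'"
    and rmc: "\<And>v u. is_rmc T v u \<Longrightarrow> is_rmc T' v u"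
    and ils: "\<And>v u. is_ils T v u \<Longrightarrow> is_ils T' v u"
    and "children T u = xs @ zs"
  shows "\<exists>ys. children T' u = ys @ zs"
  using assms(5)
proof (induction zs arbitrary: xs)
  case (Cons a zs)
  show ?case
  proof (cases zs)
    case Nil
    with Cons.prems have "is_rmc T a u" by (simp add: is_rmc_def)
    then have "is_rmc T' a u" by (rule rmc)
    with Nil show ?thesis by (metis append_butlast_last_id is_rmc_def)
  next
    case (Cons b ws)
    with Cons.prems have "is_ils T a b" unfolding is_ils_def by auto
    then have ab: "is_ils T' a b" by (rule ils)
    obtain ys where ys: "children T' u = ys @ b # ws"
      using Cons.IH[of "xs @ [a]"] Cons.prems Cons by auto
    obtain ys' where "ys = ys' @ [a]" by (rule is_ils_append[OF T(2) ab ys])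
    with ys Cons show ?thesis by auto
  qed
qed simp

lemma children_cong:
  assumes "rooted_ordered_tree T" "rooted_ordered_tree T'"
    and "\<And>v u. is_rmc T v u = is_rmc T' v u"
    and "\<And>v u. is_ils T v u = is_ils T' v u"
  shows "children T = children T'"
proof
  fix u
  obtain ys where "children T' u = ys @ children T u"
    using children_suffix[of T T' u "[]" "children T u"] assms by auto
  moreover obtain zs where "children T u = zs @ children T' u"
    using children_suffix[of T' T u "[]" "children T' u"] assms by auto
  \<comment> \<open>Each list is a suffix of the other, so \<open>ys\<close> and \<open>zs\<close>
    are empty.\<close>
  ultimately show "children T u = children T' u" by simp
qed

section \<open>Symmetry and uniqueness\<close>

text \<open>Converse of the rules that produce rightmost children. In \<open>T\<close> the vertex
  \<open>v\<close> has one of the two roles; the rules turn it into a position in \<open>S\<close>,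
  which must agree with \<open>v\<close> being rightmost below \<open>u\<close>.\<close>

lemma is_dual_is_rmcD:
  assumes T: "rooted_ordered_tree T" and "is_dual T S" and v: "is_rmc S v u"
  shows "if u = root T then is_rmc T v u else is_ils T v u"
proof -
  have S: "rooted_ordered_tree S" "verts S = verts T" "root S = root T"
    and D: "\<And>v. is_rmc T v (root T) \<Longrightarrow> is_rmc S v (root T)"
      "\<And>u v. u \<noteq> root T \<Longrightarrow> is_rmc T v u \<Longrightarrow> is_ils S v u"
      "\<And>u v. is_ils T v u \<Longrightarrow> is_rmc S v u"
    using assms(2) unfolding is_dual_def by auto
  note vS = child_in_verts[OF S(1) is_rmc_child[OF v]]
  obtain p where "v \<in> set (children T p)"
    using parent_exists[OF T, of v] vS S by auto
  then show ?thesis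
  proof (cases rule: child_cases)
    case 1
    \<comment> \<open>For any other \<open>p\<close>, rule (2) would give \<open>v\<close> a right
      sibling in \<open>S\<close>.\<close>
    then have "p = root T" using D(2) not_is_ils_and_is_rmc[OF S(1) _ v] by blast
    with 1 D(1) is_rmc_parent_unique[OF S(1) v] show ?thesis by auto
  next
    case (2 u')
    then have "u = u'" using D(3) is_rmc_parent_unique[OF S(1) v] by blast
    moreover have "u' \<noteq> root T" using 2 is_ils_siblings child_in_verts(3)[OF T] by metis
    ultimately show ?thesis using 2 by simp
  qed
qed

lemma is_dual_is_ilsD:
  assumes T: "rooted_ordered_tree T" and "is_dual T S" and v: "is_ils S v u"
  shows "u \<noteq> root T \<and> is_rmc T v u"
proof -
  have S: "rooted_ordered_tree S" "verts S = verts T" "root S = root T"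
    and D: "\<And>v. is_rmc T v (root T) \<Longrightarrow> is_rmc S v (root T)"
      "\<And>u v. u \<noteq> root T \<Longrightarrow> is_rmc T v u \<Longrightarrow> is_ils S v u"
      "\<And>u v. is_ils T v u \<Longrightarrow> is_rmc S v u"
    using assms(2) unfolding is_dual_def by auto
  obtain q where "v \<in> set (children S q)" using is_ils_siblings[OF v] by blast
  note vS = child_in_verts[OF S(1) this]
  obtain p where "v \<in> set (children T p)"
    using parent_exists[OF T, of v] vS S by auto
  then show ?thesis
  proof (cases rule: child_cases)
    case 1
    then have p: "p \<noteq> root T" using D(1) not_is_ils_and_is_rmc[OF S(1) v] by blast
    then have "u = p" using 1 D(2) is_ils_right_unique[OF S(1) v] by blast
    with p 1 show ?thesis by simp
  next
    case (2 u')
    then show ?thesis using D(3) not_is_ils_and_is_rmc[OF S(1) v] by blast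
  qed
qed

text \<open>The two converses just proved are the rules of duality with \<open>S\<close> and
  \<open>T\<close> exchanged.\<close>

lemma is_dual_sym:
  assumes "rooted_ordered_tree T" and "is_dual T S"
  shows "is_dual S T"
  using assms is_dual_is_rmcD[OF assms] is_dual_is_ilsD[OF assms]
  unfolding is_dual_def by (metis (full_types))

text \<open>The rules and their converses express both relations of a dual through \<open>T\<close>
  alone, and \<open>children_cong\<close> recovers the lists from them.\<close>

lemma is_dual_unique:
  assumes T: "rooted_ordered_tree T" and S: "is_dual T S" and S': "is_dual T S'"
  shows "S = S'"
proof -
  have "is_rmc S v u \<longleftrightarrow> is_rmc S' v u" for v u
    using is_dual_is_rmcD[OF T S] is_dual_is_rmcD[OF T S'] S S'
    unfolding is_dual_def by metis
  moreover have "is_ils S v u \<longleftrightarrow> is_ils S' v u" for v u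
    using is_dual_is_ilsD[OF T S] is_dual_is_ilsD[OF T S'] S S'
    unfolding is_dual_def by metis
  ultimately have "children S = children S'"
    using S S' by (intro children_cong) (auto simp: is_dual_def)
  with S S' show ?thesis by (simp add: is_dual_def)
qed

lemma dual_eqI:
  assumes "rooted_ordered_tree T" and "is_dual T S"
  shows "dual T = S"
  unfolding dual_def using assms is_dual_unique by (intro the_equality) auto

section \<open>Existence\<close>

text \<open>Cycles are pushed up towards the root: a cycle through a vertex passes through its only
  parent, and the root, having no parent, lies on none.\<close>

lemma acyclic_child_rel:
  assumes T: "rooted_ordered_tree T"
  shows "acyclic (child_rel T)"
proof -
  have "(x, x) \<notin> (child_rel T)\<^sup>+" if "(root T, x) \<in> (child_rel T)\<^sup>*" for x
    using that
  proof (induction rule: rtrancl_induct)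
    case base
    show ?case
    proof
      assume "(root T, root T) \<in> (child_rel T)\<^sup>+"
      then show False by (rule tranclE) (auto dest: child_in_verts(3)[OF T])
    qed
  next
    case (step y z)
    show ?case
    proof
      assume "(z, z) \<in> (child_rel T)\<^sup>+"
      then obtain w where "(z, w) \<in> (child_rel T)\<^sup>*" "(w, z) \<in> child_rel T"
        by (auto dest: tranclD2)
      moreover from this step.hyps(2) have "w = y" using parent_unique[OF T] by auto
      ultimately show False
        using step.hyps(2) step.IH by (metis rtrancl_into_trancl2)
    qed
  qed
  moreover have "x \<in> verts T" if "(x, x) \<in> (child_rel T)\<^sup>+" for x
    using that child_in_verts(2)[OF T] by (auto dest: tranclD2)
  ultimately show ?thesis
    using T unfolding acyclic_def rooted_ordered_tree_def by blast
qed

lemma wf_converse_child_rel: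
  assumes T: "rooted_ordered_tree T" and fin: "finite (verts T)"
  shows "wf ((child_rel T)\<inverse>)"
proof (rule finite_acyclic_wf_converse)
  have "child_rel T \<subseteq> verts T \<times> verts T"
    using child_in_verts[OF T] by auto
  then show "finite (child_rel T)"
    using fin by (meson finite_SigmaI finite_subset)
qed (rule acyclic_child_rel[OF T])

section \<open>Chains of successive rightmost children\<close>

text \<open>
  The chain is listed from its deepest vertex up, because a rightmost child in \<open>T\<close> becomes a left
  sibling in the dual.
\<close>

inductive spine :: "'a rotree \<Rightarrow> 'a \<Rightarrow> 'a list \<Rightarrow> bool" for T where
  leaf: "children T v = [] \<Longrightarrow> spine T v [v]"
| step: "is_rmc T w v \<Longrightarrow> spine T w xs \<Longrightarrow> spine T v (xs @ [v])"

lemma spine_exists: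
  assumes T: "rooted_ordered_tree T" and fin: "finite (verts T)"
  shows "\<exists>xs. spine T v xs"
  using wf_converse_child_rel[OF T fin]
proof (induction v rule: wf_induct_rule)
  case (less v)
  show ?case
  proof (cases "children T v = []")
    case False
    then have "is_rmc T (last (children T v)) v" by (simp add: is_rmc_def)
    moreover from this obtain xs where "spine T (last (children T v)) xs"
      using less[of "last (children T v)"] is_rmc_child by fastforce
    ultimately show ?thesis by (blast intro: spine.step)
  qed (blast intro: spine.leaf)
qed

lemma spine_last: "spine T v xs \<Longrightarrow> xs \<noteq> [] \<and> last xs = v"
  by (auto elim: spine.cases)

lemma spine_set_descendants:
  "spine T v xs \<Longrightarrow> x \<in> set xs \<Longrightarrow> (v, x) \<in> (child_rel T)\<^sup>*"
proof (induction rule: spine.induct)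
  case (step w v xs)
  then have "(v, w) \<in> child_rel T" using is_rmc_child by fastforce
  with step show ?case by (auto intro: converse_rtrancl_into_rtrancl)
qed auto

lemma spine_distinct:
  assumes T: "rooted_ordered_tree T" and "spine T v xs"
  shows "distinct xs"
  using assms(2)
proof (induction rule: spine.induct)
  case (step w v xs)
  have "v \<notin> set xs"
  proof
    assume "v \<in> set xs"
    with step.hyps(2) have "(w, v) \<in> (child_rel T)\<^sup>*" by (rule spine_set_descendants)
    moreover have "(v, w) \<in> child_rel T" using step is_rmc_child by fastforce
    ultimately have "(v, v) \<in> (child_rel T)\<^sup>+" by (rule rtrancl_into_trancl2[rotated])
    with acyclic_child_rel[OF T] show False by (simp add: acyclic_def)
  qed
  with step show ?case by simp
qed simp

lemma spine_set_cases:
  assumes "spine T v xs" "x \<in> set xs"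
  shows "x = v \<or> (\<exists>y \<in> set xs. is_rmc T x y)"
  using assms
proof (induction rule: spine.induct)
  case (step w v xs)
  then show ?case by auto
qed simp

text \<open>A spine stops only at a vertex without children, so it contains the rightmost child of
  each of its entries, placed directly before that entry.\<close>

lemma spine_is_rmc:
  assumes T: "rooted_ordered_tree T"
    and "spine T v xs" "x \<in> set xs" "is_rmc T y x"
  shows "\<exists>as bs. xs = as @ [y, x] @ bs"
  using assms(2-)
proof (induction rule: spine.induct)
  case (leaf v)
  then show ?case by (simp add: is_rmc_def)
next
  case (step w v xs)
  show ?case
  proof (cases "x = v")
    case True
    with step.hyps(1) step.prems(2) have "y = w" by (simp add: is_rmc_def)
    with True show ?thesis
      using spine_last[OF step.hyps(2)]
      by (metis append.assoc append.right_neutral append_Cons append_Nil append_butlast_last_id)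
  next
    case False
    with step obtain as bs where "xs = as @ [y, x] @ bs" by auto
    then show ?thesis by (metis append.assoc)
  qed
qed

text \<open>Climbing from \<open>x\<close> along rightmost-child steps is deterministic because
  parents are unique. The hypotheses on \<open>a\<close> and \<open>b\<close> say that the climb
  cannot continue to a non-root vertex, so it ends at the same place in both spines.\<close>

lemma spine_top_unique:
  assumes T: "rooted_ordered_tree T"
    and a: "spine T a xs" "a \<noteq> root T" "\<And>y. is_rmc T a y \<Longrightarrow> y = root T"
    and b: "spine T b ys" "b \<noteq> root T" "\<And>y. is_rmc T b y \<Longrightarrow> y = root T"
    and x: "x \<in> set xs" "x \<in> set ys"
  shows "a = b"
proof -
  \<comment> \<open>Every entry below the top has a parent, so a spine with a non-root top avoids
    the root. A step up from \<open>a\<close> or \<open>b\<close> inside a spine therefore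
    contradicts the top condition.\<close>
  have nonroot: "z \<noteq> root T" if "spine T c zs" "c \<noteq> root T" "z \<in> set zs" for c zs z
    using spine_set_cases[OF that(1,3)] that(2) child_in_verts(3)[OF T] is_rmc_child by metis
  \<comment> \<open>The induction follows this path: unless \<open>x\<close> is already a top, it is
    replaced by its parent, which again lies in both spines.\<close>
  have "(a, x) \<in> (child_rel T)\<^sup>*" using a(1) x(1) by (rule spine_set_descendants)
  from this x show ?thesis
  proof (induction rule: rtrancl_induct)
    case base
    then show ?case using spine_set_cases[OF b(1)] nonroot[OF b(1,2)] a(3) by blast
  next
    case (step y z)
    show ?case
    proof (cases "z = a \<or> z = b")
      case True
      then show ?thesis
        using spine_set_cases[OF a(1) step.prems(1)] spine_set_cases[OF b(1) step.prems(2)]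
          nonroot[OF a(1,2)] nonroot[OF b(1,2)] a(3) b(3) by blast
    next
      case False
      then obtain y1 y2 where y: "y1 \<in> set xs" "is_rmc T z y1" "y2 \<in> set ys" "is_rmc T z y2"
        using spine_set_cases[OF a(1) step.prems(1)] spine_set_cases[OF b(1) step.prems(2)]
        by blast
      then have "y1 = y" "y2 = y"
        using step.hyps(2) parent_unique[OF T, of z] is_rmc_child[of T z] by auto
      with y show ?thesis using step.IH by blast
    qed
  qed
qed

section \<open>Construction of the dual from spines\<close>

definition dual_rmc :: "'a rotree \<Rightarrow> 'a \<Rightarrow> 'a \<Rightarrow> bool" where
  "dual_rmc T v u \<longleftrightarrow> (if u = root T then is_rmc T v u else is_ils T v u)"

lemma dual_rmc_verts:
  assumes T: "rooted_ordered_tree T" and "dual_rmc T v u"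
  shows "u \<in> verts T" "v \<in> verts T" "v \<noteq> root T"
  using assms(2) child_in_verts[OF T] is_rmc_child[of T v u] is_ils_siblings[of T v u]
  unfolding dual_rmc_def by (metis (full_types))+

lemma dual_rmc_left_unique:
  assumes "rooted_ordered_tree T" "dual_rmc T v u" "dual_rmc T v' u"
  shows "v = v'"
  using assms is_ils_left_unique by (auto simp: dual_rmc_def is_rmc_def split: if_splits)

lemma dual_rmc_right_unique:
  assumes "rooted_ordered_tree T" "dual_rmc T v u" "dual_rmc T v u'"
  shows "u = u'"
  using assms not_is_ils_and_is_rmc is_ils_right_unique
  unfolding dual_rmc_def by (metis (full_types))

text \<open>This supplies the top condition of \<open>spine_top_unique\<close>: a vertex with a
  right sibling is the rightmost child of no vertex, and the rightmost child of the root has no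
  other parent.\<close>

lemma dual_rmc_is_rmc:
  assumes "rooted_ordered_tree T" "dual_rmc T v u" "is_rmc T v y"
  shows "y = root T"
  using assms not_is_ils_and_is_rmc is_rmc_parent_unique
  unfolding dual_rmc_def by (metis (full_types))

lemma is_dual_exists:
  assumes T: "rooted_ordered_tree T" and fin: "finite (verts T)"
  shows "\<exists>S. is_dual T S"
proof -
  \<comment> \<open>The list of \<open>u\<close> is the spine of its prescribed rightmost child. The
    empty list is the value where there is none, in particular outside
    \<open>verts T\<close>.\<close>
  have "\<forall>u. \<exists>xs. (\<exists>v. dual_rmc T v u \<and> spine T v xs) \<or> (\<nexists>v. dual_rmc T v u) \<and> xs = []"
    using spine_exists[OF T fin] by blast
  then obtain c where
    c: "\<And>u. (\<exists>v. dual_rmc T v u \<and> spine T v (c u)) \<or> (\<nexists>v. dual_rmc T v u) \<and> c u = []"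
    by metis
  define S where "S = \<lparr>verts = verts T, root = root T, children = c\<rparr>"
  have S: "verts S = verts T" "root S = root T" "children S = c" by (simp_all add: S_def)
  have c_spine: "spine T v (c u)" if "dual_rmc T v u" for v u
    using c[of u] that dual_rmc_left_unique[OF T] by blast
  have c_elem: "\<exists>v. dual_rmc T v u \<and> spine T v (c u)" if "x \<in> set (c u)" for x u
    using c[of u] that by auto
  have rmcS: "is_rmc S v u" if "dual_rmc T v u" for v u
    using spine_last[OF c_spine[OF that]] by (simp add: is_rmc_def S)
  have ilsS: "\<exists>as bs. c p = as @ [v, u] @ bs" if "is_rmc T v u" "u \<in> set (c p)" for v u p
    using c_elem[OF that(2)] spine_is_rmc[OF T _ that(2,1)] by blast
  have sub: "x \<in> verts T \<and> x \<noteq> root T" if "x \<in> set (c u)" for x u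
    using c_elem[OF that] spine_set_cases[of T _ "c u" x] that dual_rmc_verts[OF T]
      child_in_verts[OF T] is_rmc_child by metis
  have dist: "distinct (c u)" for u
    using c[of u] spine_distinct[OF T] by auto
  \<comment> \<open>A vertex lying in two lists forces their spines to have the same top, and the
    top determines whose list it is.\<close>
  have uniq: "p = q" if p: "x \<in> set (c p)" and q: "x \<in> set (c q)" for x p q
  proof -
    obtain a where a: "dual_rmc T a p" "spine T a (c p)" using c_elem[OF p] by blast
    obtain b where b: "dual_rmc T b q" "spine T b (c q)" using c_elem[OF q] by blast
    have "a = b"
      by (rule spine_top_unique[OF T a(2) dual_rmc_verts(3)[OF T a(1)]
            dual_rmc_is_rmc[OF T a(1)] b(2) dual_rmc_verts(3)[OF T b(1)]
            dual_rmc_is_rmc[OF T b(1)] p q])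
    with a b show ?thesis using dual_rmc_right_unique[OF T] by blast
  qed
  have reach: "(root T, v) \<in> (child_rel S)\<^sup>*" if "(root T, v) \<in> (child_rel T)\<^sup>*" for v
    using that
  proof (induction rule: rtrancl_induct)
    case (step u w)
    \<comment> \<open>Siblings are treated from right to left, hence the suffixes: the rightmost
      child joins the list containing \<open>u\<close> (or stays below the root), and every other
      child hangs below its right neighbour.\<close>
    have "\<forall>a \<in> set zs. (root T, a) \<in> (child_rel S)\<^sup>*" if "children T u = xs @ zs" for xs zs
      using that
    proof (induction zs arbitrary: xs)
      case (Cons a zs)
      have IH: "\<forall>a \<in> set zs. (root T, a) \<in> (child_rel S)\<^sup>*"
        using Cons.IH[of "xs @ [a]"] Cons.prems by simp
      moreover have "(root T, a) \<in> (child_rel S)\<^sup>*"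
      proof (cases zs)
        case Nil
        with Cons.prems have a: "is_rmc T a u" by (simp add: is_rmc_def)
        show ?thesis
        proof (cases "u = root T")
          case True
          with a have "is_rmc S a u" by (intro rmcS) (simp add: dual_rmc_def)
          with True show ?thesis by (auto dest: is_rmc_child)
        next
          case False
          \<comment> \<open>The vertex \<open>u\<close> is reachable in \<open>S\<close> and is not
            the root, so the last edge of a path provides its parent \<open>p\<close>.\<close>
          with step.IH obtain p where p: "(root T, p) \<in> (child_rel S)\<^sup>*" "u \<in> set (c p)"
            by (auto simp: S elim: rtranclE)
          then have "a \<in> set (c p)" using ilsS[OF a p(2)] by auto
          with p(1) show ?thesis by (auto simp: S intro: rtrancl_into_rtrancl)
        qed
      next
        case (Cons b ws)
        with Cons.prems have "is_ils T a b" unfolding is_ils_def by auto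
        moreover have "b \<noteq> root T"
          using Cons Cons.prems child_in_verts(3)[OF T, of b u] by simp
        ultimately have "is_rmc S a b" by (intro rmcS) (simp add: dual_rmc_def)
        then have "(b, a) \<in> child_rel S" by (auto dest: is_rmc_child)
        with IH Cons show ?thesis by (auto intro: rtrancl_into_rtrancl)
      qed
      ultimately show ?case by simp
    qed simp
    from this[of "[]" "children T u"] step.hyps(2) show ?case by simp
  qed simp
  have reach_verts: "(root T, v) \<in> (child_rel S)\<^sup>*" if "v \<in> verts T" for v
    using reach T that unfolding rooted_ordered_tree_def by blast
  \<comment> \<open>Reachability also yields existence of parents, again through the last edge of a
    path.\<close>
  have parent: "\<exists>p. v \<in> set (c p)" if "v \<in> verts T" "v \<noteq> root T" for v
    using reach_verts[OF that(1)] that(2) by (auto simp: S elim: rtranclE)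
  have "rooted_ordered_tree S"
    unfolding rooted_ordered_tree_def
  proof (intro conjI allI impI ballI)
    show "root S \<in> verts S" using T by (simp add: S rooted_ordered_tree_def)
    show "children S u = []" if "u \<notin> verts S" for u
      using c[of u] that dual_rmc_verts(1)[OF T] by (auto simp: S)
    show "\<exists>!u. v \<in> set (children S u)" if "v \<in> verts S - {root S}" for v
      using parent[of v] uniq that by (auto simp: S)
    show "(root S, v) \<in> (child_rel S)\<^sup>*" if "v \<in> verts S" for v
      using reach_verts[of v] that by (simp only: S)
  qed (use sub dist in \<open>auto simp: S\<close>)
  moreover have "is_ils S v u" if "u \<noteq> root T" "is_rmc T v u" for u v
    using parent[of u] ilsS[OF that(2)] that(1) child_in_verts(1)[OF T is_rmc_child[OF that(2)]]
    unfolding is_ils_def S by blast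
  moreover have "is_rmc S v u" if "is_ils T v u" for u v
  proof (rule rmcS)
    have "u \<noteq> root T" using that is_ils_siblings child_in_verts(3)[OF T] by metis
    with that show "dual_rmc T v u" by (simp add: dual_rmc_def)
  qed
  moreover have "is_rmc S v (root T)" if "is_rmc T v (root T)" for v
    using that by (auto intro: rmcS simp: dual_rmc_def)
  ultimately show ?thesis using S unfolding is_dual_def by blast
qed

theorem theorem4:
  fixes T :: "'a rotree"
  assumes "rooted_ordered_tree T"
    and "finite (verts T)"
  shows "dual (dual T) = T"
proof -
  obtain S where S: "is_dual T S" using is_dual_exists[OF assms] by blast
  then have "dual T = S" by (rule dual_eqI[OF assms(1)])
  moreover have "dual S = T"
    using S is_dual_sym[OF assms(1) S] by (intro dual_eqI) (auto simp: is_dual_def)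
  ultimately show ?thesis by simp
qed

end
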